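(* Let $q=p^s$ where $p$ is an odd prime and $s\geq 1$ is an integer, let $H=\{x^2\mid x\in\mathbb{F}_q^*\}$, and let $k$ be an integer with $1\leq k\leq \frac{q-1}{2}$. Let $N_H(k,0)$ be the number of $k$-element subsets $S\subseteq H$ with $\sum_{a\in S}a=0$. (1) If either $p\equiv 1 \pmod 4$, or $p\equiv 3\pmod 4$ and $s$ is even, then $$N_H(k,0)=\frac{1}{q}\binom{\frac{q-1}{2}}{k}+(-1)^k\frac{q-1}{2q\,k!}\Big\{A_{k,1}\Big(\tfrac{1-\sqrt{q}}{2},\tfrac{1+\sqrt{q}}{2},\tfrac{1-q}{2}\Big)+A_{k,1}\Big(\tfrac{1+\sqrt{q}}{2},\tfrac{1-\sqrt{q}}{2},\tfrac{1-q}{2}\Big)\Big\}.$$ (2) If $p\equiv 3\pmod 4$ and $s$ is odd, then $$N_H(k,0)=\frac{1}{q}\binom{\frac{q-1}{2}}{k}+(-1)^k\frac{q-1}{2q\,k!}\Big\{A_{k,1}\Big(\tfrac{1-\sqrt{q}i}{2},\tfrac{1+\sqrt{q}i}{2},\tfrac{1-q}{2}\Big)+A_{k,1}\Big(\tfrac{1+\sqrt{q}i}{2},\tfrac{1-\sqrt{q}i}{2},\tfrac{1-q}{2}\Big)\Big\},$$ where $i=\sqrt{-1}$.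
   Context: $\chi$ denotes the quadratic character of $\mathbb{F}_q^*$, and for an integer $j$, $\chi(j)$ means $\chi$ evaluated at the image of $j$ in $\mathbb{F}_q$. For integers $c_1,\dots,c_k\geq 0$ with $\sum_j jc_j=k$, let $N(c_1,\dots,c_k)=\frac{k!}{1^{c_1}c_1!\,2^{c_2}c_2!\cdots k^{c_k}c_k!}$. For $b\in\mathbb{F}_q^*$ and complex numbers $u,v,w$, define $$A_{k,b}(u,v,w)=\sum_{c_1,\dots,c_k\ge 0,\ \sum_j jc_j=k}N(c_1,\dots,c_k)\,t_1^{c_1}\cdots t_k^{c_k},$$ where $t_j=u$ if $p\nmid j$ and $\chi(j)=\chi(b)$; $t_j=v$ if $p\nmid j$ and $\chi(j)=-\chi(b)$; $t_j=w$ if $p\mid j$. (So $A_{k,1}$ uses $\chi(b)=1$.) For real $x$ and integer $j\ge0$, $\binom{x}{j}=x(x-1)\cdots(x-j+1)/j!$. *)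

theory Defs
  imports Complex_Main "HOL-Library.FuncSet" "HOL-Library.Cardinality"
    "HOL-Number_Theory.Cong"
begin

text \<open>The quadratic character of a finite field, with the usual extension by 0 at 0.\<close>

definition quad_char :: "'a::{field,finite} \<Rightarrow> int" where
  "quad_char x = (if x = 0 then 0 else if \<exists>y. x = y\<^sup>2 then 1 else - 1)"

text \<open>A cycle type \<open>(c\<^sub>1, \<dots>, c\<^sub>k)\<close> is a function on the index set \<open>{1..k}\<close>; extensionality
  makes distinct functions represent distinct tuples.\<close>

definition cycle_types :: "nat \<Rightarrow> (nat \<Rightarrow> nat) set" where
  "cycle_types k = {c \<in> {1..k} \<rightarrow>\<^sub>E UNIV. (\<Sum>j=1..k. j * c j) = k}"

lemma finite_cycle_types: "finite (cycle_types k)"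
proof (rule finite_subset)
  show "cycle_types k \<subseteq> {1..k} \<rightarrow>\<^sub>E {..k}"
  proof
    fix c assume c: "c \<in> cycle_types k"
    have "c j \<le> k" if "j \<in> {1..k}" for j
    proof -
      have "c j \<le> j * c j" using that by simp
      also have "\<dots> \<le> (\<Sum>j=1..k. j * c j)"
        by (rule member_le_sum[OF that]) auto
      finally show ?thesis using c by (simp add: cycle_types_def)
    qed
    with c show "c \<in> {1..k} \<rightarrow>\<^sub>E {..k}" by (auto simp: cycle_types_def PiE_iff)
  qed
qed (simp add: finite_PiE)

definition num_perms :: "nat \<Rightarrow> (nat \<Rightarrow> nat) \<Rightarrow> complex" where
  "num_perms k c = fact k / (\<Prod>j=1..k. of_nat j ^ c j * fact (c j))"

text \<open>In \<open>t_weight\<close> and \<open>A_poly\<close>, \<open>p\<close> is the characteristic of the field and \<open>b\<close> is nonzero, so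
  the last case of \<open>t_weight\<close> is exactly \<open>quad_char (of_nat j) = - quad_char b\<close>.\<close>

definition t_weight ::
  "nat \<Rightarrow> 'a::{field,finite} \<Rightarrow> complex \<Rightarrow> complex \<Rightarrow> complex \<Rightarrow> nat \<Rightarrow> complex" where
  "t_weight p b u v w j =
     (if p dvd j then w
      else if quad_char (of_nat j :: 'a) = quad_char b then u
      else v)"

definition A_poly ::
  "nat \<Rightarrow> nat \<Rightarrow> 'a::{field,finite} \<Rightarrow> complex \<Rightarrow> complex \<Rightarrow> complex \<Rightarrow> complex" where
  "A_poly p k b u v w =
     (\<Sum>c\<in>cycle_types k. num_perms k c * (\<Prod>j=1..k. t_weight p b u v w j ^ c j))"

definition num_subsets_with_sum :: "'a::ab_group_add set \<Rightarrow> nat \<Rightarrow> 'a \<Rightarrow> nat" where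
  "num_subsets_with_sum D k b = card {S. S \<subseteq> D \<and> card S = k \<and> (\<Sum>a\<in>S. a) = b}"

end

theory Submission
  imports Defs "HOL-Computational_Algebra.Formal_Power_Series"
    "HOL-Computational_Algebra.Polynomial"
begin

text \<open>Let \<open>\<psi>\<close> be a nontrivial additive character of the field. Orthogonality of the characters
  \<open>\<psi> (b * _)\<close> gives \<open>q N\<^sub>H(k,0) = \<Sum>\<^sub>b e\<^sub>k(\<psi>(b a) : a \<in> H)\<close>, where \<open>e\<^sub>k\<close> is the elementary symmetric
  polynomial. The Newton-Girard identities and the cycle index of the symmetric group satisfy the same
  recurrence, so \<open>k! e\<^sub>k\<close> is, up to sign, the cycle index sum in the negated power sums. The \<open>j\<close>-th power
  sum of the \<open>\<psi>(b a)\<close> is \<open>(\<chi>(b j) G - 1) / 2\<close>, or \<open>|H|\<close> if \<open>p\<close> divides \<open>j\<close>, where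
  \<open>G = \<Sum>\<^sub>x \<psi>(x\<^sup>2)\<close> satisfies \<open>G\<^sup>2 = \<chi>(-1) q\<close>. Half of the nonzero \<open>b\<close> are squares, so \<open>G\<close> and
  \<open>-G\<close> enter symmetrically and the sign of the Gauss sum need not be determined.\<close>

section \<open>Characteristic of the field and a nontrivial additive character\<close>

text \<open>Translation by \<open>1\<close> permutes the field, so the sum of all elements absorbs
  \<open>CARD('a)\<close> further copies of \<open>1\<close>. Hence \<open>p ^ s\<close> vanishes in
  the field, and so does \<open>p\<close>.\<close>

lemma of_nat_char_eq_0:
  assumes "CARD('a::{field,finite}) = p ^ s"
  shows "of_nat p = (0::'a)"
proof -
  have "(\<Sum>x\<in>(UNIV::'a set). x + 1) = (\<Sum>x\<in>UNIV. x)"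
    by (rule sum.reindex_bij_witness[of _ "\<lambda>x. x - 1" "\<lambda>x. x + 1"]) auto
  then have "of_nat (CARD('a)) = (0::'a)"
    by (simp add: sum.distrib)
  then show ?thesis
    using assms by simp
qed

text \<open>An inverse modulo \<open>p\<close>, carried over to the field. In the form
  \<open>of_nat j\<close> it acts on additive subgroups by repeated addition.\<close>

lemma of_nat_mult_eq_1_if_not_dvd:
  assumes "prime p" and "of_nat p = (0::'a::field)" and "\<not> p dvd i"
  obtains j where "of_nat j * of_nat i = (1::'a)"
proof -
  have "coprime i p"
    using assms(1,3) prime_imp_coprime coprime_commute by blast
  then obtain j where "[i * j = 1] (mod p)"
    using cong_solve_coprime_nat by auto
  then obtain a b where "i * j + a * p = 1 + b * p"
    by (metis cong_iff_lin_nat mult.commute)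
  then have "of_nat (i * j + a * p) = (of_nat (1 + b * p) :: 'a)"
    by (rule arg_cong)
  then have "of_nat j * of_nat i = (1::'a)"
    using assms(2) by (simp add: mult.commute)
  then show thesis ..
qed

lemma of_nat_eq_0_iff_char_dvd:
  assumes "prime p" and "of_nat p = (0::'a::field)"
  shows "of_nat j = (0::'a) \<longleftrightarrow> p dvd j"
  using of_nat_mult_eq_1_if_not_dvd[OF assms] assms(2)
  by (metis dvdE mult_zero_left mult_zero_right of_nat_mult zero_neq_one)

text \<open>An additive subgroup that is maximal among those avoiding \<open>1\<close> has index \<open>p\<close>, with the
  multiples of \<open>1\<close> as coset representatives.\<close>

lemma exists_nontrivial_additive_character:
  assumes p: "prime p" "odd p" and char: "of_nat p = (0::'a)"
  obtains \<psi> :: "'a::{field,finite} \<Rightarrow> complex"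
  where "\<And>x y. \<psi> (x + y) = \<psi> x * \<psi> y" and "\<psi> 0 = 1" and "\<psi> 1 \<noteq> 1"
proof -
  \<comment> \<open>Closure under addition is enough for a subgroup: negation is multiplication by
    \<open>p - 1\<close>.\<close>
  define good where "good = {M::'a set. 0 \<in> M \<and> (\<forall>x\<in>M. \<forall>y\<in>M. x + y \<in> M) \<and> 1 \<notin> M}"
  have "{0} \<in> good"
    by (simp add: good_def)
  then obtain M where M: "M \<in> good" and max: "\<And>N. N \<in> good \<Longrightarrow> M \<subseteq> N \<Longrightarrow> N = M"
    using finite_has_maximal[of good] by (metis empty_iff finite)
  have M0: "0 \<in> M" and Madd: "\<And>x y. x \<in> M \<Longrightarrow> y \<in> M \<Longrightarrow> x + y \<in> M" and M1: "1 \<notin> M"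
    using M by (auto simp: good_def)
  have Mmult: "of_nat n * x \<in> M" if "x \<in> M" for n x
    by (induction n) (use that M0 Madd in \<open>auto simp: algebra_simps\<close>)
  have p1: "of_nat (p - 1) = (-1::'a)"
    using prime_gt_0_nat[OF p(1)] char by (simp add: of_nat_diff)
  have Mneg: "- x \<in> M" if "x \<in> M" for x
    using Mmult[OF that, of "p - 1"] p1 by simp
  have ex: "\<exists>n. x - of_nat n \<in> M" for x
  proof (cases "x \<in> M")
    case True
    then show ?thesis by (intro exI[of _ 0]) simp
  next
    case False
    \<comment> \<open>The subgroup spanned by \<open>M\<close> and \<open>x\<close>. It is strictly
      larger than \<open>M\<close>, so maximality forces \<open>1\<close> into it; solving that
      relation for \<open>x\<close> modulo \<open>M\<close> gives the representative.\<close>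
    define N where "N = {m + of_nat i * x | m i. m \<in> M}"
    have "M \<subseteq> N"
      unfolding N_def by (force intro: exI[of _ "0::nat"])
    moreover have "x \<in> N"
      unfolding N_def using M0 by (force intro: exI[of _ "1::nat"])
    ultimately have "N \<notin> good"
      using max False by blast
    moreover have "0 \<in> N"
      using M0 \<open>M \<subseteq> N\<close> by blast
    moreover have "u + v \<in> N" if uv: "u \<in> N" "v \<in> N" for u v
    proof -
      obtain m i m' i' where "u = m + of_nat i * x" "m \<in> M" "v = m' + of_nat i' * x" "m' \<in> M"
        using uv unfolding N_def by blast
      then have "u + v = (m + m') + of_nat (i + i') * x" "m + m' \<in> M"
        using Madd by (auto simp: algebra_simps)
      then show ?thesis
        unfolding N_def by blast
    qed
    ultimately have "1 \<in> N"
      by (auto simp: good_def)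
    then obtain m i where mi: "1 = m + of_nat i * x" "m \<in> M"
      unfolding N_def by blast
    have "\<not> p dvd i"
      using mi M1 char by (auto elim!: dvdE)
    then obtain j where j: "of_nat j * of_nat i = (1::'a)"
      using of_nat_mult_eq_1_if_not_dvd p(1) char by blast
    have "of_nat j * (1::'a) = of_nat j * m + of_nat j * of_nat i * x"
      by (subst mi(1)) (simp add: algebra_simps)
    then have "x - of_nat j = - (of_nat j * m)"
      using j by (simp add: algebra_simps)
    then show ?thesis
      using Mneg Mmult mi(2) by metis
  qed
  define f where "f x = (SOME n. x - of_nat n \<in> M)" for x
  have f: "x - of_nat (f x) \<in> M" for x
    unfolding f_def using ex by (rule someI_ex)
  define w where "w = cis (2 * pi / p)"
  have wp: "w ^ p = 1"
    using prime_gt_0_nat[OF p(1)] by (simp add: w_def DeMoivre)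
  \<comment> \<open>Oddness gives \<open>2 * pi / p < pi\<close>, so the sine is positive and
    \<open>w\<close> is not real.\<close>
  have "p > 2"
    using p prime_ge_2_nat[of p] by (cases "p = 2") auto
  then have "sin (2 * pi / p) > 0"
    by (intro sin_gt_zero) (auto simp: field_simps)
  then have w1: "w \<noteq> 1"
    by (auto simp: w_def complex_eq_iff)
  have w0: "w \<noteq> 0"
    by (simp add: w_def)
  \<comment> \<open>Makes \<open>w ^ f x\<close> depend only on the coset of \<open>x\<close>, so
    the arbitrary choice in \<open>f\<close> does no harm.\<close>
  have weq: "w ^ a = w ^ b" if ab: "of_nat a - of_nat b \<in> M" for a b
  proof -
    \<comment> \<open>Represents \<open>a - b\<close> modulo \<open>p\<close> without truncated
      subtraction.\<close>
    let ?n = "a + (p - 1) * b"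
    have n: "of_nat ?n \<in> M"
      using ab p1 by simp
    have "p dvd ?n"
    proof (rule ccontr)
      assume "\<not> p dvd ?n"
      then obtain j where "of_nat j * of_nat ?n = (1::'a)"
        using of_nat_mult_eq_1_if_not_dvd p(1) char by blast
      then show False
        using Mmult[OF n, of j] M1 by simp
    qed
    then have "w ^ ?n = 1"
      using wp by (auto elim!: dvdE simp: power_mult)
    moreover have "w ^ (b + (p - 1) * b) = 1"
    proof -
      have "b + (p - 1) * b = p * b"
        using prime_gt_0_nat[OF p(1)] by (cases p) auto
      then show ?thesis using wp by (simp add: power_mult)
    qed
    ultimately show ?thesis
      using w0 by (metis mult_right_cancel power_add power_not_zero)
  qed
  show thesis
  proof
    show "w ^ f (x + y) = w ^ f x * w ^ f y" for x y
    proof -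
      have "(x - of_nat (f x)) + (y - of_nat (f y)) + - (x + y - of_nat (f (x + y))) \<in> M"
        using f Madd Mneg by blast
      then have "of_nat (f (x + y)) - of_nat (f x + f y) \<in> M"
        by (simp add: algebra_simps)
      then have "w ^ f (x + y) = w ^ (f x + f y)"
        by (rule weq)
      then show ?thesis by (simp add: power_add)
    qed
    show "w ^ f 0 = 1"
      using weq[of 0 "f 0"] f[of 0] by simp
    show "w ^ f 1 \<noteq> 1"
      using weq[of 1 "f 1"] f[of 1] w1 by simp
  qed
qed

section \<open>Elementary symmetric polynomials and Newton's identities\<close>

definition elem_sym :: "'b set \<Rightarrow> ('b \<Rightarrow> 'c::comm_ring_1) \<Rightarrow> nat \<Rightarrow> 'c" where
  "elem_sym A z m = (\<Sum>B | B \<subseteq> A \<and> card B = m. \<Prod>a\<in>B. z a)"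

lemma elem_sym_0: "finite A \<Longrightarrow> elem_sym A z 0 = 1"
proof -
  assume "finite A"
  then have "{B. B \<subseteq> A \<and> card B = 0} = {{}}"
    by (auto dest: finite_subset)
  then show ?thesis
    by (simp add: elem_sym_def)
qed

text \<open>Picking \<open>z a * X\<close> or \<open>1\<close> from each factor indexes the expanded
  product by subsets, with the size of the subset as exponent.\<close>

lemma fps_nth_prod_elem_sym:
  assumes "finite A"
  shows "fps_nth (\<Prod>a\<in>A. fps_const (z a) * fps_X + 1) m = elem_sym A z m"
proof -
  have const: "(\<Prod>a\<in>B. fps_const (z a)) = fps_const (\<Prod>a\<in>B. z a)" for B
    by (induction B rule: infinite_finite_induct) auto
  have "(\<Prod>a\<in>A. fps_const (z a) * fps_X + 1) = (\<Sum>B\<in>Pow A. fps_const (\<Prod>a\<in>B. z a) * fps_X ^ card B)"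
    by (simp add: prod_add assms prod.distrib const)
  then have "fps_nth (\<Prod>a\<in>A. fps_const (z a) * fps_X + 1) m
     = (\<Sum>B\<in>Pow A. if card B = m then \<Prod>a\<in>B. z a else 0)"
    by (auto simp: fps_sum_nth intro!: sum.cong)
  also have "\<dots> = elem_sym A z m"
    using assms unfolding elem_sym_def
    by (subst sum.inter_filter[symmetric]) (auto intro!: sum.cong)
  finally show ?thesis .
qed

text \<open>With \<open>E = \<Prod>(1 + z X)\<close>, the logarithmic derivative \<open>X E' / E\<close> is the sum of the geometric series
  \<open>R (z a) = z a X / (1 + z a X)\<close>.\<close>

lemma newton_girard:
  fixes z :: "'b \<Rightarrow> 'c::comm_ring_1"
  assumes "finite A"
  shows "of_nat m * elem_sym A z m =
    (\<Sum>j=1..m. (- 1) ^ (j - 1) * (\<Sum>a\<in>A. z a ^ j) * elem_sym A z (m - j))"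
proof -
  define E where "E A = (\<Prod>a\<in>A. fps_const (z a) * fps_X + 1)" for A
  define R where "R x = Abs_fps (\<lambda>j. if j = 0 then 0 else (- 1) ^ (j - 1) * x ^ j)" for x :: 'c
  have R: "(fps_const x * fps_X + 1) * R x = fps_const x * fps_X" for x
  proof (rule fps_ext)
    fix n show "fps_nth ((fps_const x * fps_X + 1) * R x) n = fps_nth (fps_const x * fps_X) n"
    proof (cases n)
      case (Suc l)
      then show ?thesis
        by (cases l) (auto simp: R_def algebra_simps)
    qed (simp add: R_def algebra_simps)
  qed
  \<comment> \<open>The logarithmic derivative with denominators cleared. Insertion is the product
    rule, where \<open>R\<close> turns the derivative \<open>z a\<close> of the new factor into a
    multiple of that factor.\<close>
  have "fps_X * fps_deriv (E A) = (\<Sum>a\<in>A. R (z a)) * E A"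
    using assms
  proof (induction A rule: finite_induct)
    case (insert a A)
    let ?L = "fps_const (z a) * fps_X + 1"
    have "fps_X * fps_deriv (E (insert a A)) = ?L * (fps_X * fps_deriv (E A)) + (fps_const (z a) * fps_X) * E A"
      using insert(1,2) by (simp add: E_def algebra_simps)
    also have "\<dots> = ?L * (\<Sum>a\<in>A. R (z a)) * E A + ?L * R (z a) * E A"
      by (simp only: insert.IH R mult.assoc)
    also have "\<dots> = (\<Sum>a\<in>insert a A. R (z a)) * E (insert a A)"
      using insert(1,2) by (simp add: E_def algebra_simps)
    finally show ?case .
  qed (simp add: E_def)
  then have "fps_nth (fps_X * fps_deriv (E A)) m = fps_nth ((\<Sum>a\<in>A. R (z a)) * E A) m"
    by simp
  also have "fps_nth (fps_X * fps_deriv (E A)) m = of_nat m * elem_sym A z m"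
    using fps_nth_prod_elem_sym[OF assms, of z] by (cases m) (auto simp: E_def)
  also have "fps_nth ((\<Sum>a\<in>A. R (z a)) * E A) m
      = (\<Sum>j=0..m. fps_nth (\<Sum>a\<in>A. R (z a)) j * elem_sym A z (m - j))"
    using fps_nth_prod_elem_sym[OF assms, of z] by (simp add: fps_mult_nth E_def)
  \<comment> \<open>Each \<open>R (z a)\<close> has constant coefficient 0, so the convolution
    starts at \<open>j = 1\<close>.\<close>
  also have "\<dots> = (\<Sum>j=1..m. (- 1) ^ (j - 1) * (\<Sum>a\<in>A. z a ^ j) * elem_sym A z (m - j))"
    by (rule sum.mono_neutral_cong_right)
       (auto simp: fps_sum_nth R_def sum_distrib_left)
  finally show ?thesis .
qed

section \<open>The cycle index and its recurrence\<close>

text \<open>The index bound \<open>n\<close> is separate from the weight \<open>m\<close>, so that a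
  recurrence can lower \<open>m\<close> on a fixed index set; \<open>n = m = k\<close> gives
  \<open>cycle_types k\<close>.\<close>

definition weight_types :: "nat \<Rightarrow> nat \<Rightarrow> (nat \<Rightarrow> nat) set" where
  "weight_types n m = {c \<in> {1..n} \<rightarrow>\<^sub>E UNIV. (\<Sum>j=1..n. j * c j) = m}"

text \<open>The coefficient of \<open>x^m\<close> in the exponential of the sum of
  \<open>t j * x^j / j\<close> over \<open>1 <= j <= n\<close>; for \<open>n = m\<close> it is the
  cycle index of the symmetric group on \<open>m\<close> letters.\<close>

definition cycle_index :: "nat \<Rightarrow> (nat \<Rightarrow> complex) \<Rightarrow> nat \<Rightarrow> complex" where
  "cycle_index n t m =
     (\<Sum>c\<in>weight_types n m. \<Prod>j=1..n. t j ^ c j / (of_nat j ^ c j * fact (c j)))"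

lemma finite_weight_types: "finite (weight_types n m)"
proof (rule finite_subset)
  show "weight_types n m \<subseteq> {1..n} \<rightarrow>\<^sub>E {..m}"
  proof
    fix c assume c: "c \<in> weight_types n m"
    have "c j \<le> m" if "j \<in> {1..n}" for j
    proof -
      have "c j \<le> j * c j" using that by simp
      also have "\<dots> \<le> (\<Sum>j=1..n. j * c j)"
        by (rule member_le_sum[OF that]) auto
      finally show ?thesis using c by (simp add: weight_types_def)
    qed
    with c show "c \<in> {1..n} \<rightarrow>\<^sub>E {..m}" by (auto simp: weight_types_def PiE_iff)
  qed
qed (simp add: finite_PiE)

lemma cycle_index_0: "cycle_index n t 0 = 1"
proof -
  have "weight_types n 0 = {\<lambda>j\<in>{1..n}. 0}"
    by (auto simp: weight_types_def PiE_iff extensional_def fun_eq_iff restrict_def)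
  then show ?thesis
    by (simp add: cycle_index_def)
qed

text \<open>Weight a term by \<open>m = (\<Sum>j. j * c j)\<close> and lower one \<open>c j\<close> by \<open>1\<close>.\<close>

lemma cycle_index_rec:
  assumes "m \<le> n"
  shows "of_nat m * cycle_index n t m = (\<Sum>j=1..m. t j * cycle_index n t (m - j))"
proof -
  define W where "W c = (\<Prod>j=1..n. t j ^ c j / (of_nat j ^ c j * fact (c j)))" for c
  have step: "(\<Sum>c\<in>weight_types n m. of_nat (j * c j) * W c)
      = (if j \<le> m then t j * cycle_index n t (m - j) else 0)" if j: "j \<in> {1..n}" for j
  proof (cases "j \<le> m")
    case False
    have "c j = 0" if c: "c \<in> weight_types n m" for c
    proof (rule ccontr)
      assume "c j \<noteq> 0"
      then have "j \<le> j * c j" by simp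
      also have "\<dots> \<le> (\<Sum>j=1..n. j * c j)"
        by (rule member_le_sum[OF j]) auto
      finally show False using c False by (simp add: weight_types_def)
    qed
    then have "(\<Sum>c\<in>weight_types n m. of_nat (j * c j) * W c) = 0"
      by (intro sum.neutral) auto
    then show ?thesis using False by simp
  next
    case True
    have upd: "(\<Sum>i=1..n. i * (c(j := Suc (c j))) i) = (\<Sum>i=1..n. i * c i) + j" for c
    proof -
      have "(\<Sum>i=1..n. i * (c(j := Suc (c j))) i) = (\<Sum>i=1..n. i * c i + (if i = j then j else 0))"
        by (rule sum.cong) auto
      then show ?thesis
        using j by (simp add: sum.distrib)
    qed
    have "(\<Sum>c\<in>weight_types n m. of_nat (j * c j) * W c)
        = (\<Sum>c | c \<in> weight_types n m \<and> c j \<noteq> 0. of_nat (j * c j) * W c)"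
      by (rule sum.mono_neutral_right) (auto simp: finite_weight_types)
    also have "\<dots> = (\<Sum>c\<in>weight_types n (m - j). t j * W c)"
    proof (rule sum.reindex_bij_witness[of _ "\<lambda>c. c(j := Suc (c j))" "\<lambda>c. c(j := c j - 1)"])
      fix c assume c: "c \<in> {c \<in> weight_types n m. c j \<noteq> 0}"
      define c' where "c' = c(j := c j - 1)"
      have cc': "c = c'(j := Suc (c' j))"
        using c by (auto simp: c'_def)
      then show "(c(j := c j - 1)) (j := Suc ((c(j := c j - 1)) j)) = c"
        by (simp add: c'_def)
      have "(\<Sum>i=1..n. i * c i) = m"
        using c by (simp add: weight_types_def)
      then have "(\<Sum>i=1..n. i * c' i) = m - j"
        using upd[of c'] cc' by simp
      then show "c(j := c j - 1) \<in> weight_types n (m - j)"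
        using c j unfolding c'_def[symmetric]
        by (auto simp: weight_types_def PiE_iff extensional_def c'_def)
      have rest: "(\<Prod>i\<in>{1..n}-{j}. t i ^ c i / (of_nat i ^ c i * fact (c i)))
         = (\<Prod>i\<in>{1..n}-{j}. t i ^ c' i / (of_nat i ^ c' i * fact (c' i)))"
        by (rule prod.cong) (auto simp: c'_def)
      obtain l where l: "c j = Suc l" "c' j = l"
        using c by (cases "c j") (auto simp: c'_def)
      \<comment> \<open>The weight \<open>j * c j\<close> cancels one factor \<open>j\<close> and
        turns \<open>fact (c j)\<close> into \<open>fact (c j - 1)\<close>.\<close>
      have "of_nat (Suc l) \<noteq> (0::complex)" "of_nat j \<noteq> (0::complex)"
        using j by (auto simp del: of_nat_Suc)
      then have "of_nat (j * Suc l) * (t j ^ Suc l / (of_nat j ^ Suc l * fact (Suc l)))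
         = t j * (t j ^ l / (of_nat j ^ l * fact l))"
        unfolding fact_Suc of_nat_mult power_Suc by (simp del: of_nat_Suc)
      then show "t j * W (c(j := c j - 1)) = of_nat (j * c j) * W c"
        unfolding c'_def[symmetric] W_def
        unfolding prod.remove[OF finite_atLeastAtMost j] rest l
        by (simp only: mult.assoc[symmetric])
    next
      fix c assume c: "c \<in> weight_types n (m - j)"
      then show "c(j := Suc (c j)) \<in> {c \<in> weight_types n m. c j \<noteq> 0}"
        using upd[of c] j True by (auto simp: weight_types_def PiE_iff extensional_def)
    qed auto
    also have "\<dots> = t j * cycle_index n t (m - j)"
      by (simp add: cycle_index_def W_def sum_distrib_left)
    finally show ?thesis using True by simp
  qed
  have "of_nat m * cycle_index n t m = (\<Sum>c\<in>weight_types n m. of_nat (\<Sum>j=1..n. j * c j) * W c)"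
    unfolding cycle_index_def sum_distrib_left W_def
    by (rule sum.cong) (auto simp: weight_types_def)
  also have "\<dots> = (\<Sum>j=1..n. \<Sum>c\<in>weight_types n m. of_nat (j * c j) * W c)"
    by (subst sum.swap) (simp add: sum_distrib_right)
  also have "\<dots> = (\<Sum>j=1..n. if j \<le> m then t j * cycle_index n t (m - j) else 0)"
    by (rule sum.cong) (use step in auto)
  also have "\<dots> = (\<Sum>j=1..m. t j * cycle_index n t (m - j))"
    using assms by (intro sum.mono_neutral_cong_right) auto
  finally show ?thesis .
qed

text \<open>Up to sign, \<open>newton_girard\<close> and \<open>cycle_index_rec\<close> are the same
  recurrence, so strong induction on \<open>m\<close> applies with \<open>n\<close> fixed; dividing
  by \<open>m\<close> is possible over the complex numbers.\<close>

lemma elem_sym_eq_cycle_index: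
  assumes "finite A" and "m \<le> n"
  shows "elem_sym A z m = (- 1) ^ m * cycle_index n (\<lambda>j. - (\<Sum>a\<in>A. z a ^ j)) m"
  using assms(2)
proof (induction m rule: less_induct)
  case (less m)
  let ?t = "\<lambda>j. - (\<Sum>a\<in>A. z a ^ j)"
  show ?case
  proof (cases "m = 0")
    case True
    then show ?thesis using assms(1) by (simp add: elem_sym_0 cycle_index_0)
  next
    case False
    have "of_nat m * elem_sym A z m =
      (\<Sum>j=1..m. (- 1) ^ (j - 1) * (\<Sum>a\<in>A. z a ^ j) * elem_sym A z (m - j))"
      by (rule newton_girard[OF assms(1)])
    also have "\<dots> = (\<Sum>j=1..m. (- 1) ^ m * (?t j * cycle_index n ?t (m - j)))"
    proof (rule sum.cong)
      fix j assume j: "j \<in> {1..m}"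
      then have "elem_sym A z (m - j) = (- 1) ^ (m - j) * cycle_index n ?t (m - j)"
        using less.IH[of "m - j"] less.prems by auto
      \<comment> \<open>The two exponents add up to \<open>m - 1\<close>; the remaining sign is that
        of the negated power sum.\<close>
      moreover have "(- 1) ^ m = - ((- 1) ^ (j - 1) * (- 1) ^ (m - j) :: complex)"
      proof -
        have "m = Suc ((j - 1) + (m - j))" using j by auto
        then show ?thesis by (metis mult_minus1 power_Suc power_add)
      qed
      ultimately show "(- 1) ^ (j - 1) * (\<Sum>a\<in>A. z a ^ j) * elem_sym A z (m - j)
         = (- 1) ^ m * (?t j * cycle_index n ?t (m - j))"
        by simp
    qed simp
    also have "\<dots> = of_nat m * ((- 1) ^ m * cycle_index n ?t m)"
      by (simp only: sum_distrib_left[symmetric] cycle_index_rec[OF less.prems, symmetric] ac_simps)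
    finally show ?thesis using False by simp
  qed
qed

lemma A_poly_eq_cycle_index:
  "A_poly p k b u v w = fact k * cycle_index k (t_weight p b u v w) k"
  by (simp add: A_poly_def cycle_index_def weight_types_def cycle_types_def num_perms_def
      sum_distrib_left prod_dividef)

section \<open>Nonzero squares and the quadratic character\<close>

definition nonzero_squares :: "'a::field set" where
  "nonzero_squares = {x\<^sup>2 | x. x \<noteq> 0}"

lemma quad_char_nonzero:
  "b \<noteq> 0 \<Longrightarrow> quad_char b = (if b \<in> nonzero_squares then 1 else - 1)"
  by (auto simp: quad_char_def nonzero_squares_def)

lemma mult_mem_nonzero_squares:
  assumes "a \<in> nonzero_squares" and "b \<noteq> 0"
  shows "b * a \<in> nonzero_squares \<longleftrightarrow> b \<in> nonzero_squares"
proof -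
  obtain x where x: "a = x\<^sup>2" "x \<noteq> 0"
    using assms(1) by (auto simp: nonzero_squares_def)
  have "b \<in> nonzero_squares" if ba: "b * a \<in> nonzero_squares"
  proof -
    obtain y where "b * a = y\<^sup>2" "y \<noteq> 0"
      using ba by (auto simp: nonzero_squares_def)
    then have "b = (y / x)\<^sup>2" "y / x \<noteq> 0"
      using x by (auto simp: field_simps)
    then show ?thesis unfolding nonzero_squares_def by blast
  qed
  moreover have "b * a \<in> nonzero_squares" if b: "b \<in> nonzero_squares"
  proof -
    obtain y where "b = y\<^sup>2" "y \<noteq> 0"
      using b by (auto simp: nonzero_squares_def)
    then have "b * a = (y * x)\<^sup>2" "y * x \<noteq> 0"
      using x by (auto simp: power_mult_distrib)
    then show ?thesis unfolding nonzero_squares_def by blast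
  qed
  ultimately show ?thesis by blast
qed

lemma zero_notin_nonzero_squares [simp]: "0 \<notin> nonzero_squares"
  by (auto simp: nonzero_squares_def)

text \<open>Each nonzero square has exactly two roots \<open>y\<close> and \<open>- y\<close>,
  distinct because \<open>2\<close> is nonzero, while \<open>0\<close> has one.\<close>

lemma sum_comp_square:
  fixes f :: "'a::{field,finite} \<Rightarrow> 'b::comm_semiring_1"
  assumes "(2::'a) \<noteq> 0"
  shows "(\<Sum>x\<in>UNIV. f (x\<^sup>2)) = f 0 + 2 * (\<Sum>a\<in>nonzero_squares. f a)"
proof -
  have fib: "(\<Sum>x\<in>{x \<in> UNIV - {0}. x\<^sup>2 = a}. f (x\<^sup>2)) = 2 * f a"
    if a: "a \<in> nonzero_squares" for a :: 'a
  proof -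
    obtain y where y: "a = y\<^sup>2" "y \<noteq> 0"
      using a by (auto simp: nonzero_squares_def)
    have "{x \<in> UNIV - {0}. x\<^sup>2 = a} = {y, - y}"
      using y by (auto simp: power2_eq_iff)
    moreover have "y \<noteq> - y"
    proof
      assume "y = - y"
      then have "2 * y = 0" by (metis mult_2 add.right_inverse)
      then show False using y assms by simp
    qed
    ultimately have "(\<Sum>x\<in>{x \<in> UNIV - {0}. x\<^sup>2 = a}. f (x\<^sup>2)) = f (y\<^sup>2) + f (y\<^sup>2)"
      by simp
    then show ?thesis by (simp only: y(1) mult_2)
  qed
  have "(\<Sum>x\<in>UNIV. f (x\<^sup>2)) = f 0 + (\<Sum>x\<in>UNIV - {0}. f (x\<^sup>2))"
    by (simp add: sum.remove[of UNIV 0])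
  also have "(\<Sum>x\<in>UNIV - {0}. f (x\<^sup>2))
      = (\<Sum>a\<in>nonzero_squares. \<Sum>x\<in>{x \<in> UNIV - {0}. x\<^sup>2 = a}. f (x\<^sup>2))"
    by (rule sum.group[symmetric]) (auto simp: nonzero_squares_def)
  also have "\<dots> = 2 * (\<Sum>a\<in>nonzero_squares. f a)"
    using fib by (simp add: sum_distrib_left)
  finally show ?thesis .
qed

lemma card_eq_nonzero_squares:
  assumes "(2::'a::{field,finite}) \<noteq> 0"
  shows "CARD('a) = 1 + 2 * card (nonzero_squares :: 'a set)"
  using sum_comp_square[OF assms, of "\<lambda>_. 1::nat"] by simp

text \<open>Inclusion follows from multiplicativity. Multiplication by \<open>b\<close> is injective
  and squares and nonsquares are equally many, so inclusion becomes equality.\<close>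

lemma mult_image_nonzero_squares:
  fixes b :: "'a::{field,finite}"
  assumes "(2::'a) \<noteq> 0" and "b \<noteq> 0"
  shows "(*) b ` nonzero_squares =
    (if b \<in> nonzero_squares then nonzero_squares else UNIV - {0} - nonzero_squares)"
proof (rule card_subset_eq)
  have "card ((*) b ` nonzero_squares) = card (nonzero_squares :: 'a set)"
    using assms(2) by (intro card_image) (auto simp: inj_on_def)
  moreover have "card (UNIV - {0} - nonzero_squares :: 'a set) = card (nonzero_squares :: 'a set)"
    using card_eq_nonzero_squares[OF assms(1)] by (subst card_Diff_subset) auto
  ultimately show "card ((*) b ` nonzero_squares) =
    card (if b \<in> nonzero_squares then nonzero_squares else UNIV - {0} - nonzero_squares :: 'a set)"
    by simp
qed (use assms(2) mult_mem_nonzero_squares[of _ b] in \<open>auto split: if_splits\<close>)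

text \<open>The nonzero squares are roots of \<open>X\<^sup>n - 1\<close> with \<open>n\<close> their number, hence all its roots.\<close>

lemma minus_one_mem_nonzero_squares_iff:
  assumes "(2::'a::{field,finite}) \<noteq> 0"
  shows "(- 1 :: 'a) \<in> nonzero_squares \<longleftrightarrow> even (card (nonzero_squares :: 'a set))"
proof -
  let ?H = "nonzero_squares :: 'a set"
  have pow: "a ^ card ?H = 1" if "a \<in> ?H" for a
  proof -
    have a: "a \<noteq> 0" using that by auto
    \<comment> \<open>As for Fermat's little theorem: multiplication by \<open>a\<close> permutes
      \<open>?H\<close>, and the nonzero product over \<open>?H\<close> cancels.\<close>
    have "\<Prod>?H = \<Prod>((*) a ` ?H)"
      using mult_image_nonzero_squares[OF assms a] that by simp
    also have "\<dots> = (\<Prod>h\<in>?H. a * h)"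
      using a by (subst prod.reindex) (auto simp: inj_on_def)
    also have "\<dots> = a ^ card ?H * \<Prod>?H"
      by (simp add: prod.distrib)
    finally have "(a ^ card ?H - 1) * \<Prod>?H = 0"
      by (simp add: algebra_simps)
    moreover have "\<Prod>?H \<noteq> 0"
      by (auto simp: prod_zero_iff)
    ultimately show ?thesis by simp
  qed
  have neg: "(-1::'a) \<noteq> 1"
    using assms by (metis add.right_inverse one_add_one)
  show ?thesis
  proof
    assume "- 1 \<in> ?H"
    from pow[OF this] show "even (card ?H)"
      using neg by (auto simp: minus_one_power_iff split: if_splits)
  next
    assume even: "even (card ?H)"
    have "1 \<in> ?H"
      unfolding nonzero_squares_def by (auto intro!: exI[of _ 1])
    then have n: "card ?H > 0"
      by (auto simp: card_gt_0_iff)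
    define P where "P = monom (1::'a) (card ?H) - 1"
    have roots: "poly P x = 0 \<longleftrightarrow> x ^ card ?H = 1" for x
      by (simp add: P_def poly_monom)
    have "coeff P (card ?H) = 1"
      using n by (simp add: P_def card_gt_0_iff)
    then have P0: "P \<noteq> 0" by auto
    have "degree P \<le> card ?H"
      unfolding P_def by (rule degree_diff_le) (auto simp: degree_monom_le)
    then have "card {x. poly P x = 0} \<le> card ?H"
      using card_poly_roots_bound[OF P0] by simp
    moreover have "?H \<subseteq> {x. poly P x = 0}"
      using pow roots by auto
    ultimately have "?H = {x. poly P x = 0}"
      by (intro card_seteq) auto
    moreover have "poly P (-1) = 0"
      using even by (simp add: roots)
    ultimately show "- 1 \<in> ?H" by auto
  qed
qed

section \<open>Additive characters and quadratic Gauss sums\<close>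

locale odd_field_character =
  fixes \<psi> :: "'a::{field,finite} \<Rightarrow> complex"
  assumes add: "\<psi> (x + y) = \<psi> x * \<psi> y"
    and zero: "\<psi> 0 = 1"
    and nontrivial: "\<psi> 1 \<noteq> 1"
    and two_neq_0: "(2::'a) \<noteq> 0"
begin

text \<open>For nonzero \<open>b\<close> this agrees with the Gauss sum of
  \<open>quad_char a * \<psi> (b * a)\<close>, since \<open>a\<close> has
  \<open>1 + quad_char a\<close> square roots.\<close>

definition gauss :: "'a \<Rightarrow> complex" where
  "gauss b = (\<Sum>x\<in>UNIV. \<psi> (b * x\<^sup>2))"

lemma psi_sum: "\<psi> (\<Sum>a\<in>A. g a) = (\<Prod>a\<in>A. \<psi> (g a))"
  by (induction A rule: infinite_finite_induct) (auto simp: add zero)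

lemma psi_power: "\<psi> x ^ n = \<psi> (of_nat n * x)"
  by (induction n) (auto simp: add zero algebra_simps)

text \<open>For nonzero \<open>c\<close>, shifting \<open>x\<close> by \<open>1 / c\<close>
  multiplies the sum by \<open>\<psi> 1\<close>, which is not 1, so the sum vanishes.\<close>

lemma sum_psi_mult: "(\<Sum>x\<in>UNIV. \<psi> (c * x)) = (if c = 0 then of_nat (CARD('a)) else 0)"
proof (cases "c = 0")
  case False
  have "(\<Sum>x\<in>UNIV. \<psi> (c * x)) = (\<Sum>x\<in>UNIV. \<psi> (c * x + 1))"
    using False
    by (intro sum.reindex_bij_witness[of _ "\<lambda>x. x + 1 / c" "\<lambda>x. x - 1 / c"])
       (auto simp: field_simps)
  also have "\<dots> = \<psi> 1 * (\<Sum>x\<in>UNIV. \<psi> (c * x))"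
    by (simp add: add sum_distrib_left mult.commute)
  finally have "(\<psi> 1 - 1) * (\<Sum>x\<in>UNIV. \<psi> (c * x)) = 0"
    by (simp add: algebra_simps)
  then show ?thesis using nontrivial False by simp
qed (simp add: zero)

lemma gauss_eq: "gauss b = 1 + 2 * (\<Sum>a\<in>nonzero_squares. \<psi> (b * a))"
  unfolding gauss_def using sum_comp_square[OF two_neq_0, of "\<lambda>x. \<psi> (b * x)"] by (simp add: zero)

text \<open>A square \<open>b\<close> permutes the nonzero squares. A nonsquare exchanges them with
  the nonsquares, and then the two Gauss sums add up to twice a full character sum, which is
  0.\<close>

lemma gauss_mult:
  assumes "b \<noteq> 0" and "c \<noteq> 0"
  shows "gauss (b * c) = of_int (quad_char b) * gauss c"
proof -
  have "(\<Sum>a\<in>nonzero_squares. \<psi> (b * c * a)) = (\<Sum>a\<in>(*) b ` nonzero_squares. \<psi> (c * a))"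
    using assms by (subst sum.reindex) (auto simp: inj_on_def algebra_simps)
  then have bc: "gauss (b * c) = 1 + 2 * (\<Sum>a\<in>(*) b ` nonzero_squares. \<psi> (c * a))"
    by (simp add: gauss_eq)
  show ?thesis
  proof (cases "b \<in> nonzero_squares")
    case True
    then show ?thesis
      using assms bc gauss_eq[of c] mult_image_nonzero_squares[OF two_neq_0, of b]
      by (simp add: quad_char_nonzero)
  next
    case False
    have "(\<Sum>x\<in>UNIV. \<psi> (c * x)) = 1 + (\<Sum>x\<in>UNIV - {0}. \<psi> (c * x))"
      by (simp add: sum.remove[of UNIV 0] zero)
    also have "(\<Sum>x\<in>UNIV - {0}. \<psi> (c * x)) =
       (\<Sum>x\<in>UNIV - {0} - nonzero_squares. \<psi> (c * x)) + (\<Sum>x\<in>nonzero_squares. \<psi> (c * x))"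
      by (rule sum.subset_diff) auto
    finally have "1 + ((\<Sum>x\<in>UNIV - {0} - nonzero_squares. \<psi> (c * x))
        + (\<Sum>x\<in>nonzero_squares. \<psi> (c * x))) = 0"
      using assms by (simp add: sum_psi_mult)
    moreover have "gauss (b * c) + gauss c = 2 * (1 + ((\<Sum>x\<in>UNIV - {0} - nonzero_squares. \<psi> (c * x))
        + (\<Sum>x\<in>nonzero_squares. \<psi> (c * x))))"
      using mult_image_nonzero_squares[OF two_neq_0 assms(1)] False
      unfolding bc gauss_eq[of c] by simp
    ultimately have "gauss (b * c) + gauss c = 0"
      by simp
    then show ?thesis
      using assms False by (simp add: quad_char_nonzero add_eq_0_iff)
  qed
qed

text \<open>Substituting \<open>u = x + y\<close>, \<open>v = x - y\<close> in the double sum over \<open>\<psi> (x\<^sup>2 - y\<^sup>2)\<close>.\<close>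

lemma gauss_mult_gauss_minus_one: "gauss 1 * gauss (- 1) = of_nat (CARD('a))"
proof -
  have half: "(u + v) / 2 + (u - v) / 2 = u" "(u + v) / 2 - (u - v) / 2 = v"
     "(u + v + (u - v)) / 2 = u" "(u + v - (u - v)) / 2 = v" for u v :: 'a
    using two_neq_0
    by (simp_all add: add_divide_distrib[symmetric] diff_divide_distrib[symmetric] mult_2[symmetric])
  have "gauss 1 * gauss (- 1) = (\<Sum>x\<in>UNIV. \<Sum>y\<in>UNIV. \<psi> (x\<^sup>2) * \<psi> (- (y\<^sup>2)))"
    by (simp add: gauss_def sum_product)
  also have "\<dots> = (\<Sum>(x,y)\<in>UNIV \<times> UNIV. \<psi> ((x + y) * (x - y)))"
    unfolding sum.cartesian_product
    by (intro sum.cong) (auto simp: add[symmetric] algebra_simps power2_eq_square)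
  also have "\<dots> = (\<Sum>(u,v)\<in>UNIV \<times> UNIV. \<psi> (u * v))"
    by (rule sum.reindex_bij_witness[of _ "\<lambda>(u,v). ((u + v) / 2, (u - v) / 2)" "\<lambda>(x,y). (x + y, x - y)"])
       (use half in \<open>auto simp del: add_divide_distrib diff_divide_distrib\<close>)
  also have "\<dots> = (\<Sum>u\<in>UNIV. \<Sum>v\<in>UNIV. \<psi> (u * v))"
    by (simp add: sum.cartesian_product)
  also have "\<dots> = of_nat (CARD('a))"
    by (simp add: sum_psi_mult)
  finally show ?thesis .
qed

lemma gauss_square: "(gauss 1)\<^sup>2 = of_int (quad_char (- 1 :: 'a)) * of_nat (CARD('a))"
proof -
  have "gauss (- 1) = of_int (quad_char (- 1 :: 'a)) * gauss 1"
    using gauss_mult[of "- 1" 1] by simp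
  moreover have "quad_char (- 1 :: 'a) = 1 \<or> quad_char (- 1 :: 'a) = - 1"
    by (simp add: quad_char_def)
  ultimately show ?thesis
    using gauss_mult_gauss_minus_one by (auto simp: power2_eq_square)
      (metis minus_minus)
qed

section \<open>Counting zero-sum subsets by orthogonality\<close>

lemma card_mult_num_subsets_with_sum:
  "of_nat (CARD('a)) * of_nat (num_subsets_with_sum D k 0)
     = (\<Sum>b\<in>UNIV. elem_sym D (\<lambda>a. \<psi> (b * a)) k)"
proof -
  have "(\<Sum>b\<in>UNIV. elem_sym D (\<lambda>a. \<psi> (b * a)) k)
      = (\<Sum>B | B \<subseteq> D \<and> card B = k. \<Sum>b\<in>UNIV. \<psi> (\<Sum>B * b))"
    unfolding elem_sym_def
    by (subst sum.swap) (simp add: psi_sum[symmetric] sum_distrib_left mult.commute)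
  also have "\<dots> = (\<Sum>B | B \<subseteq> D \<and> card B = k. if \<Sum>B = 0 then of_nat (CARD('a)) else 0)"
    by (simp add: sum_psi_mult)
  also have "\<dots> = (\<Sum>B | (B \<subseteq> D \<and> card B = k) \<and> \<Sum>B = 0. of_nat (CARD('a)))"
    by (subst sum.inter_filter[symmetric]) auto
  also have "\<dots> = of_nat (CARD('a)) * of_nat (num_subsets_with_sum D k 0)"
    by (simp add: num_subsets_with_sum_def conj_assoc)
  finally show ?thesis ..
qed

text \<open>The \<open>j\<close>-th power replaces \<open>b\<close> by \<open>j * b\<close>, hence
  the Gauss sum by its multiple with \<open>quad_char j\<close>. The dependence on \<open>b\<close>
  is absorbed into \<open>\<sigma>\<close>, which is why the weight is taken at
  \<open>1\<close>.\<close>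

lemma power_sum_psi:
  assumes "prime p" and "of_nat p = (0::'a)" and "b \<noteq> 0"
  defines "\<sigma> \<equiv> of_int (quad_char b) * gauss 1"
  shows "- (\<Sum>a\<in>nonzero_squares. \<psi> (b * a) ^ j) =
    t_weight p (1::'a) ((1 - \<sigma>) / 2) ((1 + \<sigma>) / 2) ((1 - of_nat (CARD('a))) / 2) j"
proof -
  have pow: "(\<Sum>a\<in>nonzero_squares. \<psi> (b * a) ^ j) = (\<Sum>a\<in>nonzero_squares. \<psi> (of_nat j * b * a))"
    by (simp add: psi_power mult.assoc)
  show ?thesis
  proof (cases "p dvd j")
    case True
    then have "of_nat j = (0::'a)"
      using of_nat_eq_0_iff_char_dvd assms(1,2) by blast
    then show ?thesis
      using True card_eq_nonzero_squares[OF two_neq_0] by (simp add: pow zero t_weight_def)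
  next
    case False
    then have j: "of_nat j \<noteq> (0::'a)"
      using of_nat_eq_0_iff_char_dvd assms(1,2) by blast
    then have "gauss (of_nat j * b) = of_int (quad_char (of_nat j :: 'a)) * \<sigma>"
      using gauss_mult[of "of_nat j" b] gauss_mult[of b 1] assms(3) by (simp add: \<sigma>_def)
    then have "- (\<Sum>a\<in>nonzero_squares. \<psi> (b * a) ^ j)
       = (1 - of_int (quad_char (of_nat j :: 'a)) * \<sigma>) / 2"
      unfolding pow gauss_eq by (simp add: field_simps)
    moreover have "quad_char (1::'a) = 1"
      by (auto simp: quad_char_def intro: exI[of _ 1])
    moreover have "quad_char (of_nat j :: 'a) = 1 \<or> quad_char (of_nat j :: 'a) = - 1"
      using j by (simp add: quad_char_def)
    ultimately show ?thesis
      using False by (auto simp: t_weight_def)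
  qed
qed

text \<open>In the orthogonality sum, \<open>b = 0\<close> counts all \<open>k\<close>-subsets and
  yields the binomial coefficient. The squares and the nonsquares contribute
  \<open>(q - 1) / 2\<close> equal terms each, with \<open>gauss 1\<close> and
  \<open>- gauss 1\<close> respectively.\<close>

lemma num_subsets_nonzero_squares:
  fixes k p :: nat
  assumes "prime p" and "of_nat p = (0::'a)"
  defines "q \<equiv> CARD('a)"
  defines "B \<equiv> \<lambda>\<sigma>. A_poly p k (1::'a) ((1 - \<sigma>) / 2) ((1 + \<sigma>) / 2) ((1 - of_nat q) / 2)"
  shows "of_nat (num_subsets_with_sum (nonzero_squares::'a set) k 0) =
         1 / of_nat q * of_real (((real q - 1) / 2) gchoose k)
         + (- 1) ^ k * ((of_nat q - 1) / (2 * of_nat q * fact k)) * (B (gauss 1) + B (- gauss 1))"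
proof -
  let ?H = "nonzero_squares :: 'a set"
  let ?e = "\<lambda>b. elem_sym ?H (\<lambda>a. \<psi> (b * a)) k"
  have q: "q = 1 + 2 * card ?H"
    unfolding q_def by (rule card_eq_nonzero_squares[OF two_neq_0])
  have e: "?e b = (- 1) ^ k / fact k * B (of_int (quad_char b) * gauss 1)" if "b \<noteq> 0" for b
  proof -
    have "?e b = (- 1) ^ k * cycle_index k (\<lambda>j. - (\<Sum>a\<in>?H. \<psi> (b * a) ^ j)) k"
      by (rule elem_sym_eq_cycle_index) auto
    also have "\<dots> = (- 1) ^ k / fact k * B (of_int (quad_char b) * gauss 1)"
      unfolding B_def A_poly_eq_cycle_index power_sum_psi[OF assms(1,2) that] q_def by simp
    finally show ?thesis .
  qed
  have "?e 0 = of_nat (card ?H choose k)"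
    by (simp add: elem_sym_def zero n_subsets)
  moreover have "(\<Sum>b\<in>?H. ?e b) = of_nat (card ?H) * ((- 1) ^ k / fact k * B (gauss 1))"
  proof -
    have "?e b = (- 1) ^ k / fact k * B (gauss 1)" if "b \<in> ?H" for b
    proof -
      have "b \<noteq> 0" using that by auto
      then show ?thesis using e that by (simp add: quad_char_nonzero)
    qed
    then show ?thesis by simp
  qed
  moreover have "(\<Sum>b\<in>UNIV - {0} - ?H. ?e b) = of_nat (card ?H) * ((- 1) ^ k / fact k * B (- gauss 1))"
  proof -
    have "card (UNIV - {0} - ?H) = card ?H"
      using q unfolding q_def by (subst card_Diff_subset) auto
    moreover have "?e b = (- 1) ^ k / fact k * B (- gauss 1)" if "b \<in> UNIV - {0} - ?H" for b
      using e[of b] that by (simp add: quad_char_nonzero)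
    ultimately show ?thesis by simp
  qed
  moreover have "(\<Sum>b\<in>UNIV. ?e b) = ?e 0 + ((\<Sum>b\<in>UNIV - {0} - ?H. ?e b) + (\<Sum>b\<in>?H. ?e b))"
    by (subst sum.subset_diff[symmetric]) (auto simp: sum.remove[of UNIV 0])
  ultimately have "of_nat q * of_nat (num_subsets_with_sum ?H k 0) =
      of_nat (card ?H choose k)
      + of_nat (card ?H) * ((- 1) ^ k / fact k * (B (gauss 1) + B (- gauss 1)))"
    unfolding q_def card_mult_num_subsets_with_sum by (simp add: algebra_simps)
  moreover have "of_nat (card ?H choose k) = complex_of_real (((real q - 1) / 2) gchoose k)"
    by (simp add: q binomial_gbinomial[symmetric])
  moreover have "of_nat (card ?H) = (of_nat q - 1) / (2::complex)" "of_nat q \<noteq> (0::complex)"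
    by (auto simp: q simp del: of_nat_Suc) (simp add: of_nat_Suc)
  ultimately show ?thesis
    by (simp add: field_simps)
qed

end

theorem theorem5p2:
  fixes p s q k :: nat
    and H :: "'a::{field,finite} set"
  assumes "prime p" and "odd p" and "s \<ge> 1"
    and "q = p ^ s" and "CARD('a) = q"
    and "H = {x\<^sup>2 | x. x \<noteq> 0}"
    and "1 \<le> k" and "k \<le> (q - 1) div 2"
  shows
    "([p = 1] (mod 4) \<or> ([p = 3] (mod 4) \<and> even s) \<longrightarrow>
       of_nat (num_subsets_with_sum H k 0) =
         1 / of_nat q * of_real (((real q - 1) / 2) gchoose k)
         + (- 1) ^ k * ((of_nat q - 1) / (2 * of_nat q * fact k)) *
           (A_poly p k (1::'a) ((1 - of_real (sqrt q)) / 2) ((1 + of_real (sqrt q)) / 2)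
              ((1 - of_nat q) / 2)
            + A_poly p k (1::'a) ((1 + of_real (sqrt q)) / 2) ((1 - of_real (sqrt q)) / 2)
              ((1 - of_nat q) / 2)))
   \<and> ([p = 3] (mod 4) \<and> odd s \<longrightarrow>
       of_nat (num_subsets_with_sum H k 0) =
         1 / of_nat q * of_real (((real q - 1) / 2) gchoose k)
         + (- 1) ^ k * ((of_nat q - 1) / (2 * of_nat q * fact k)) *
           (A_poly p k (1::'a) ((1 - of_real (sqrt q) * \<i>) / 2) ((1 + of_real (sqrt q) * \<i>) / 2)
              ((1 - of_nat q) / 2)
            + A_poly p k (1::'a) ((1 + of_real (sqrt q) * \<i>) / 2) ((1 - of_real (sqrt q) * \<i>) / 2)
              ((1 - of_nat q) / 2)))"
proof -
  have char: "of_nat p = (0::'a)"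
    by (rule of_nat_char_eq_0) (use assms in simp)
  obtain \<psi> :: "'a \<Rightarrow> complex"
    where psi: "\<And>x y. \<psi> (x + y) = \<psi> x * \<psi> y" "\<psi> 0 = 1" "\<psi> 1 \<noteq> 1"
    using exists_nontrivial_additive_character[OF assms(1,2) char] by blast
  have "\<not> p dvd 2"
    using assms(1,2) primes_dvd_imp_eq two_is_prime_nat by blast
  then have two: "(2::'a) \<noteq> 0"
    using of_nat_eq_0_iff_char_dvd[OF assms(1) char, of 2] by simp
  interpret odd_field_character \<psi>
    by unfold_locales (use psi two in auto)
  have H: "H = nonzero_squares"
    using assms(6) by (simp add: nonzero_squares_def)
  define B where "B \<sigma> = A_poly p k (1::'a) ((1 - \<sigma>) / 2) ((1 + \<sigma>) / 2) ((1 - of_nat q) / 2)" for \<sigma>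
  define rhs where "rhs \<sigma> = 1 / of_nat q * of_real (((real q - 1) / 2) gchoose k)
         + (- 1) ^ k * ((of_nat q - 1) / (2 * of_nat q * fact k)) * (B \<sigma> + B (- \<sigma>))" for \<sigma>
  have "of_nat (num_subsets_with_sum H k 0) = rhs (gauss 1)"
    using num_subsets_nonzero_squares[OF assms(1) char, of k] assms(5)
    unfolding H rhs_def B_def by simp
  \<comment> \<open>By this symmetry any square root of \<open>(gauss 1)\<^sup>2\<close> may replace
    \<open>gauss 1\<close>.\<close>
  moreover have "rhs (- \<sigma>) = rhs \<sigma>" for \<sigma>
    by (simp add: rhs_def add.commute)
  ultimately have N: "of_nat (num_subsets_with_sum H k 0) = rhs \<sigma>" if "(gauss 1)\<^sup>2 = \<sigma>\<^sup>2" for \<sigma>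
    using that by (metis power2_eq_iff)
  have card: "q = 1 + 2 * card (nonzero_squares :: 'a set)"
    using card_eq_nonzero_squares[OF two] assms(5) by simp
  \<comment> \<open>The sign is \<open>quad_char (- 1)\<close>, decided by the parity of the number
    \<open>(q - 1) / 2\<close> of nonzero squares.\<close>
  have sq: "(gauss 1)\<^sup>2 = (if q mod 4 = 1 then of_nat q else - of_nat q)"
  proof -
    have "even (card (nonzero_squares :: 'a set)) \<longleftrightarrow> q mod 4 = 1"
      using card by presburger
    then show ?thesis
      using minus_one_mem_nonzero_squares_iff[OF two] gauss_square assms(5)
      by (simp add: quad_char_nonzero)
  qed
  have sqrt: "(complex_of_real (sqrt q))\<^sup>2 = of_nat q"
    by (simp flip: of_real_power)
  have "of_nat (num_subsets_with_sum H k 0) = rhs (of_real (sqrt q))"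
    if "[p = 1] (mod 4) \<or> ([p = 3] (mod 4) \<and> even s)"
  proof -
    have "[q = 1] (mod 4)"
      using that
    proof
      assume "[p = 1] (mod 4)"
      then show ?thesis using cong_pow[of p 1 4 s] assms(4) by simp
    next
      assume *: "[p = 3] (mod 4) \<and> even s"
      then obtain r where r: "s = 2 * r" by (auto elim: evenE)
      have "[p\<^sup>2 = 3\<^sup>2] (mod 4)" using * cong_pow by blast
      then have "[p\<^sup>2 = 1] (mod 4)" by (simp add: cong_def)
      from cong_pow[OF this, of r] show ?thesis using assms(4) r by (simp add: power_mult)
    qed
    then show ?thesis
      by (intro N) (simp add: sq sqrt cong_def)
  qed
  moreover have "of_nat (num_subsets_with_sum H k 0) = rhs (of_real (sqrt q) * \<i>)"
    if "[p = 3] (mod 4) \<and> odd s"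
  proof -
    obtain r where r: "s = 2 * r + 1" using \<open>[p = 3] (mod 4) \<and> odd s\<close> by (auto elim: oddE)
    have "[p\<^sup>2 = 3\<^sup>2] (mod 4)" using that cong_pow by blast
    then have "[p\<^sup>2 = 1] (mod 4)" by (simp add: cong_def)
    \<comment> \<open>For odd \<open>s\<close>, \<open>q\<close> is \<open>p\<close> times a power
      of \<open>p\<^sup>2\<close>, and \<open>p\<^sup>2\<close> is 1 modulo 4.\<close>
    from cong_mult[OF cong_pow[OF this, of r], of p 3] that have "[q = 3] (mod 4)"
      unfolding assms(4) r power_add power_mult power_one_right by simp
    then show ?thesis
      by (intro N) (simp add: sq sqrt cong_def power_mult_distrib)
  qed
  ultimately show ?thesis
    unfolding rhs_def B_def by simp
qed

end
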